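(* Let $J\subseteq I$ be such that for every $x\in J$ and every integer $n\ge0$, $p_n(x)$ and $q_n(x)$ are defined and $B_n(x)\ne0$. Suppose that the continued fraction $$\cfrac{q_0(x)}{p_0(x)+\cfrac{q_1(x)}{p_1(x)+\cfrac{q_2(x)}{p_2(x)+\cdots}}}$$ converges pointwise on $J$ to a function $\alpha$, i.e. $\lim_{N\to\infty}A_N(x)/B_N(x)=\alpha(x)$ for all $x\in J$. Then for every $x\in J$ the following series converges and $$\alpha(x)=\sum_{n=0}^\infty(-1)^n\frac{q_0(x)q_1(x)\cdots q_n(x)}{B_n(x)B_{n-1}(x)}.$$
   Context: Let $I\subseteq\mathbb{R}$ be an interval and $\lambda_0,s_0\in C^\infty(I)$ (real- or complex-valued), with $\lambda_0(x)\neq 0$ for all $x\in I$; these are the coefficients of the ODE $y''=\lambda_0 y'+s_0 y$. Functions $p_n,q_n$: $p_0=\lambda_0$, $q_0=s_0$ on $D_0=I$, and for $n\ge1$ $$p_n=p_{n-1}+\frac{q_{n-1}'}{q_{n-1}},\qquad q_n=q_{n-1}+p_{n-1}'-p_{n-1}\frac{q_{n-1}'}{q_{n-1}}$$ on the relatively open set $D_n=\{x\in D_{n-1}: q_{n-1}(x)\ne0\}$. "$p_n(x)$ and $q_n(x)$ are defined" means $x\in D_n$. Partial numerators and denominators: $A_n=p_nA_{n-1}+q_nA_{n-2}$, $A_{-1}=0$, $A_{-2}=1$, and $B_n=p_nB_{n-1}+q_nB_{n-2}$, $B_{-1}=1$, $B_{-2}=0$, for $n\ge 0$. *)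

theory Defs
  imports "HOL-Analysis.Analysis"
begin

text \<open>The class \<open>C\<^sup>\<infinity>(I)\<close>: derivatives of all orders exist on \<open>I\<close>, one-sided at endpoints belonging
  to \<open>I\<close>. The witness \<open>F k\<close> is the \<open>k\<close>-th derivative. The values are taken in an arbitrary
  \<open>real_normed_field\<close>, which includes \<open>real\<close> and \<open>complex\<close>.\<close>

definition smooth_on :: "real set \<Rightarrow> (real \<Rightarrow> 'a::real_normed_field) \<Rightarrow> bool" where
  "smooth_on I f \<longleftrightarrow>
     (\<exists>F :: nat \<Rightarrow> real \<Rightarrow> 'a.
        (\<forall>x\<in>I. F 0 x = f x) \<and>
        (\<forall>k. \<forall>x\<in>I. (F k has_vector_derivative F (Suc k) x) (at x within I)))"

text \<open>The functions \<open>p\<^sub>n\<close>, \<open>q\<^sub>n\<close> and their common domain \<open>D\<^sub>n\<close>. Since HOL functions are total,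
  \<open>aim_p I lam0 s0 n\<close> and \<open>aim_q I lam0 s0 n\<close> are meaningful only on \<open>aim_dom I lam0 s0 n\<close>; accordingly,
  they are differentiated within that set.\<close>

fun aim_p :: "real set \<Rightarrow> (real \<Rightarrow> 'a::real_normed_field) \<Rightarrow> (real \<Rightarrow> 'a) \<Rightarrow> nat \<Rightarrow> real \<Rightarrow> 'a"
  and aim_q :: "real set \<Rightarrow> (real \<Rightarrow> 'a::real_normed_field) \<Rightarrow> (real \<Rightarrow> 'a) \<Rightarrow> nat \<Rightarrow> real \<Rightarrow> 'a"
  and aim_dom :: "real set \<Rightarrow> (real \<Rightarrow> 'a::real_normed_field) \<Rightarrow> (real \<Rightarrow> 'a) \<Rightarrow> nat \<Rightarrow> real set"
where
  "aim_p I lam0 s0 0 = lam0"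
| "aim_p I lam0 s0 (Suc n) = (\<lambda>x.
     aim_p I lam0 s0 n x
     + vector_derivative (aim_q I lam0 s0 n) (at x within aim_dom I lam0 s0 n) / aim_q I lam0 s0 n x)"
| "aim_q I lam0 s0 0 = s0"
| "aim_q I lam0 s0 (Suc n) = (\<lambda>x.
     aim_q I lam0 s0 n x
     + vector_derivative (aim_p I lam0 s0 n) (at x within aim_dom I lam0 s0 n)
     - aim_p I lam0 s0 n x
       * (vector_derivative (aim_q I lam0 s0 n) (at x within aim_dom I lam0 s0 n) / aim_q I lam0 s0 n x))"
| "aim_dom I lam0 s0 0 = I"
| "aim_dom I lam0 s0 (Suc n) = {x \<in> aim_dom I lam0 s0 n. aim_q I lam0 s0 n x \<noteq> 0}"

text \<open>Partial numerators \<open>A\<close> and denominators \<open>B\<close> of the continued fraction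
  \<open>q\<^sub>0 / (p\<^sub>0 + q\<^sub>1 / (p\<^sub>1 + \<dots>))\<close>. The index is shifted by two, because the recurrences start at
  \<open>-2\<close>: \<open>cf_num p q (n + 2)\<close> is \<open>A\<^sub>n\<close> and \<open>cf_den p q (n + 2)\<close> is \<open>B\<^sub>n\<close>.\<close>

fun cf_num :: "(nat \<Rightarrow> 'a::real_normed_field) \<Rightarrow> (nat \<Rightarrow> 'a) \<Rightarrow> nat \<Rightarrow> 'a" where
  "cf_num p q 0 = 1"
| "cf_num p q (Suc 0) = 0"
| "cf_num p q (Suc (Suc n)) = p n * cf_num p q (Suc n) + q n * cf_num p q n"

fun cf_den :: "(nat \<Rightarrow> 'a::real_normed_field) \<Rightarrow> (nat \<Rightarrow> 'a) \<Rightarrow> nat \<Rightarrow> 'a" where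
  "cf_den p q 0 = 0"
| "cf_den p q (Suc 0) = 1"
| "cf_den p q (Suc (Suc n)) = p n * cf_den p q (Suc n) + q n * cf_den p q n"

end

(* Since A_n B_(n-1) - A_(n-1) B_n = (-1)^n q_0 ... q_n, the n-th term of the series is the
   difference of consecutive convergents A_n/B_n - A_(n-1)/B_(n-1), so the series telescopes. *)
theory Submission
  imports Defs
begin

text \<open>At a fixed point the recurrences are linear in numbers. The determinant of two
  consecutive columns of numerators and denominators is computed in \<open>cf_determinant\<close>;
  dividing it by the two denominators gives the telescoping differences that
  \<open>cf_partial_sum\<close> adds up. Convergence of the convergents is then convergence of the
  series.\<close>

lemma cf_determinant:
  "cf_num p q (Suc n) * cf_den p q n - cf_num p q n * cf_den p q (Suc n)
     = (- 1) ^ Suc n * (\<Prod>k<n. q k)"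
proof (induction n)
  case 0
  then show ?case by simp
next
  case (Suc n)
  \<comment> \<open>Expanding the newest column by the recurrence, the \<open>p n\<close> terms
    cancel and the rest is the previous determinant with its columns swapped, hence the factor
    \<open>- q n\<close>.\<close>
  have "cf_num p q (Suc (Suc n)) * cf_den p q (Suc n) - cf_num p q (Suc n) * cf_den p q (Suc (Suc n))
      = - q n * (cf_num p q (Suc n) * cf_den p q n - cf_num p q n * cf_den p q (Suc n))"
    by (simp add: algebra_simps)
  also have "\<dots> = (- 1) ^ Suc (Suc n) * (\<Prod>k<Suc n. q k)"
    unfolding Suc.IH by (simp add: algebra_simps)
  finally show ?case .
qed

text \<open>The telescoping starts from \<open>A_(-1) / B_(-1) = 0 / 1\<close>, so no constant term
  is left over.\<close>

lemma cf_partial_sum: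
  assumes "\<And>n. cf_den p q (n + 2) \<noteq> 0"
  shows "(\<Sum>n<N. (- 1) ^ n * ((\<Prod>k\<le>n. q k) / (cf_den p q (n + 2) * cf_den p q (n + 1))))
     = cf_num p q (N + 1) / cf_den p q (N + 1)"
proof (induction N)
  case 0
  then show ?case by simp
next
  case (Suc N)
  \<comment> \<open>The hypothesis starts at \<open>B_0\<close>; for \<open>N = 0\<close> the second
    denominator is \<open>B_(-1) = 1\<close>.\<close>
  have nz: "cf_den p q (Suc (Suc N)) \<noteq> 0" "cf_den p q (Suc N) \<noteq> 0"
    using assms[of N] assms[of "N - 1"] by (cases N; simp)+
  have "(- 1) ^ N * (\<Prod>k\<le>N. q k)
      = cf_num p q (Suc (Suc N)) * cf_den p q (Suc N) - cf_num p q (Suc N) * cf_den p q (Suc (Suc N))"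
    unfolding cf_determinant by (simp add: lessThan_Suc_atMost)
  then have "(- 1) ^ N * ((\<Prod>k\<le>N. q k) / (cf_den p q (Suc (Suc N)) * cf_den p q (Suc N)))
      = cf_num p q (Suc (Suc N)) / cf_den p q (Suc (Suc N)) - cf_num p q (Suc N) / cf_den p q (Suc N)"
    using nz by (simp add: diff_frac_eq del: cf_num.simps cf_den.simps)
  with Suc.IH show ?case
    by (simp del: cf_num.simps cf_den.simps)
qed

theorem mainTheorem4:
  fixes I J :: "real set"
    and lam0 s0 \<alpha> :: "real \<Rightarrow> 'a::real_normed_field"
    and p q :: "nat \<Rightarrow> real \<Rightarrow> 'a"
    and A B :: "nat \<Rightarrow> real \<Rightarrow> 'a"
  defines "p \<equiv> aim_p I lam0 s0"
    and "q \<equiv> aim_q I lam0 s0"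
    and "A \<equiv> (\<lambda>n x. cf_num (\<lambda>k. p k x) (\<lambda>k. q k x) n)"
    and "B \<equiv> (\<lambda>n x. cf_den (\<lambda>k. p k x) (\<lambda>k. q k x) n)"
  assumes "is_interval I"
    and "smooth_on I lam0"
    and "smooth_on I s0"
    and "\<forall>x\<in>I. lam0 x \<noteq> 0"
    and "J \<subseteq> I"
    and "\<forall>x\<in>J. \<forall>n. x \<in> aim_dom I lam0 s0 n \<and> B (n + 2) x \<noteq> 0"
    and "\<forall>x\<in>J. (\<lambda>N. A (N + 2) x / B (N + 2) x) \<longlonglongrightarrow> \<alpha> x"
  shows "\<forall>x\<in>J. (\<lambda>n. (- 1) ^ n * ((\<Prod>k\<le>n. q k x) / (B (n + 2) x * B (n + 1) x))) sums \<alpha> x"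
proof
  fix x assume x: "x \<in> J"
  have "B (n + 2) x \<noteq> 0" for n
    using assms(10) x by blast
  then have "(\<lambda>N. \<Sum>n<N. (- 1) ^ n * ((\<Prod>k\<le>n. q k x) / (B (n + 2) x * B (n + 1) x)))
      = (\<lambda>N. A (N + 1) x / B (N + 1) x)"
    unfolding A_def B_def by (intro ext cf_partial_sum)
  \<comment> \<open>The sum of the first \<open>N\<close> terms is the convergent of index
    \<open>N - 1\<close>, one behind the assumed limit; the shift does not change the limit.\<close>
  moreover have "(\<lambda>N. A (N + 1) x / B (N + 1) x) \<longlonglongrightarrow> \<alpha> x"
    by (rule LIMSEQ_imp_Suc) (use assms(11) x in simp)
  ultimately show "(\<lambda>n. (- 1) ^ n * ((\<Prod>k\<le>n. q k x) / (B (n + 2) x * B (n + 1) x))) sums \<alpha> x"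
    by (simp add: sums_def)
qed

end
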